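(* Let $a,b\in\mathbb{N}_0$ and let $\nu,k\in\mathbb{N}$. There is a bijection $\varphi$ between $T^{a,b}(\nu,k)$ and the set of $(an+b)$-color compositions of $\nu$ with exactly $k$ parts.
   Context: $\mathbb{N}=\{1,2,3,\dots\}$ and $\mathbb{N}_0=\mathbb{N}\cup\{0\}$. Colored compositions: a composition of a positive integer $\nu$ with $k$ parts is an ordered $k$-tuple $(j_1,\dots,j_k)$ of positive integers (parts) with $j_1+\dots+j_k=\nu$. An $(an+b)$-color composition of $\nu$ is a composition of $\nu$ in which each part equal to $n$ is assigned one of $an+b$ available colors (if $an+b=0$, the integer $n$ is not used as a part). Domino compositions: for $n\in\mathbb{N}$, an $n$-domino is an ordered pair $(\alpha,\beta)$ of integers with $0<\alpha\le n$ and $0\le\beta\le n$. It is called a zero $n$-domino if $\beta=0$, and a nonzero $n$-domino if $\beta>0$. An $n$-domino composition of a positive integer $N$ is a finite sequence of $n$-dominos $(\alpha_1,\beta_1),\dots,(\alpha_k,\beta_k)$ such that $\sum_{i=1}^k(\alpha_i+\beta_i)=N$. For $a,b\in\mathbb{N}_0$, $n,k\in\mathbb{N}$ and $0\le j\le k$, $T^{a,b}_j(n,k)$ is the set of $n$-domino compositions of $n+j$ consisting of $k$ dominos, of which $j$ are nonzero $n$-dominos, each assigned one of $a$ available colors, and $k-j$ are zero $n$-dominos, each assigned one of $b$ available colors. For $j>k$, $T^{a,b}_j(n,k)$ is empty. Finally, $T^{a,b}(n,k)=\bigcup_{j=0}^n T^{a,b}_j(n,k)$. *)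

theory Defs
  imports Main
begin

text \<open>
  Throughout, one of \<open>c\<close> available colors is a natural number below \<open>c\<close>; a colored object is
  the pair of the object and its color.
\<close>

definition compositions :: "nat \<Rightarrow> nat \<Rightarrow> nat list set" where
  "compositions \<nu> k = {js. length js = k \<and> (\<forall>j\<in>set js. 0 < j) \<and> sum_list js = \<nu>}"

definition color_compositions :: "nat \<Rightarrow> nat \<Rightarrow> nat \<Rightarrow> nat \<Rightarrow> (nat \<times> nat) list set" where
  "color_compositions a b \<nu> k =
     {ps. map fst ps \<in> compositions \<nu> k \<and> (\<forall>(n, c)\<in>set ps. c < a * n + b)}"

definition dominos :: "nat \<Rightarrow> (nat \<times> nat) set" where
  "dominos n = {(\<alpha>, \<beta>). 0 < \<alpha> \<and> \<alpha> \<le> n \<and> 0 \<le> \<beta> \<and> \<beta> \<le> n}"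

definition zero_domino :: "nat \<times> nat \<Rightarrow> bool" where
  "zero_domino d \<longleftrightarrow> snd d = 0"

definition nonzero_domino :: "nat \<times> nat \<Rightarrow> bool" where
  "nonzero_domino d \<longleftrightarrow> snd d > 0"

definition domino_compositions :: "nat \<Rightarrow> nat \<Rightarrow> (nat \<times> nat) list set" where
  "domino_compositions n N =
     {ds. set ds \<subseteq> dominos n \<and> (\<Sum>(\<alpha>, \<beta>)\<leftarrow>ds. \<alpha> + \<beta>) = N}"

text \<open>
  The two counts together with the length make \<open>T_nonzero a b j n k\<close> empty for \<open>j > k\<close>, so the truncated
  subtraction \<open>k - j\<close> needs no side condition.
\<close>

definition T_nonzero ::
    "nat \<Rightarrow> nat \<Rightarrow> nat \<Rightarrow> nat \<Rightarrow> nat \<Rightarrow> ((nat \<times> nat) \<times> nat) list set" where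
  "T_nonzero a b j n k =
     {ds. map fst ds \<in> domino_compositions n (n + j) \<and> length ds = k \<and>
          length (filter nonzero_domino (map fst ds)) = j \<and>
          length (filter zero_domino (map fst ds)) = k - j \<and>
          (\<forall>(d, c)\<in>set ds. (nonzero_domino d \<longrightarrow> c < a) \<and> (zero_domino d \<longrightarrow> c < b))}"

definition T_all :: "nat \<Rightarrow> nat \<Rightarrow> nat \<Rightarrow> nat \<Rightarrow> ((nat \<times> nat) \<times> nat) list set" where
  "T_all a b n k = (\<Union>j\<in>{0..n}. T_nonzero a b j n k)"

end

theory Submission
  imports Defs
begin

text \<open>
  The bijection acts domino by domino. A part equal to \<open>n\<close> has \<open>a * n + b\<close> colors. Of
  these, \<open>b\<close> colors account for the zero domino \<open>(n, 0)\<close>. The remaining \<open>a * n\<close> colors account for the nonzero dominos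
  \<open>(\<alpha>, \<beta>)\<close> with \<open>\<alpha> + \<beta> = n + 1\<close>, because there are exactly \<open>n\<close> of them (\<open>\<beta> = 1, \<dots>, n\<close>), each in
  \<open>a\<close> colors. So a colored domino is the same thing as a colored part
  (\<open>bij_betw_part_of_domino\<close>), where the part is the sum of the domino if the domino is zero, and
  one less if it is nonzero.

  Along a sequence of dominos the parts therefore add up to the total of the dominos minus the
  number \<open>j\<close> of nonzero dominos (\<open>sum_domino_eq\<close>). Total \<open>\<nu> + j\<close> for the dominos thus means
  total \<open>\<nu>\<close> for the parts, uniformly in \<open>j\<close>, and the bounds on the entries of a \<open>\<nu>\<close>-domino and on
  \<open>j\<close> follow from this total alone (\<open>T_all_eq\<close>).
\<close>

text \<open>
  The entries of a domino carry no upper bound here, so that one bijection serves for all \<open>\<nu>\<close>.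
\<close>

definition colored_dominos :: "nat \<Rightarrow> nat \<Rightarrow> ((nat \<times> nat) \<times> nat) set" where
  "colored_dominos a b = {((\<alpha>, \<beta>), c). 0 < \<alpha> \<and> c < (if \<beta> = 0 then b else a)}"

definition colored_parts :: "nat \<Rightarrow> nat \<Rightarrow> (nat \<times> nat) set" where
  "colored_parts a b = {(n, c). 0 < n \<and> c < a * n + b}"

text \<open>
  Colors below \<open>b\<close> are kept for the zero domino; a color \<open>b + e\<close> encodes in base \<open>a\<close> the pair
  consisting of \<open>\<beta> - 1 = e div a\<close> and the color \<open>e mod a\<close> of the nonzero domino.
\<close>

fun part_of_domino :: "nat \<Rightarrow> nat \<Rightarrow> (nat \<times> nat) \<times> nat \<Rightarrow> nat \<times> nat" where
  "part_of_domino a b ((\<alpha>, \<beta>), c) =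
     (if \<beta> = 0 then (\<alpha>, c) else (\<alpha> + \<beta> - 1, b + (a * (\<beta> - 1) + c)))"

fun domino_of_part :: "nat \<Rightarrow> nat \<Rightarrow> nat \<times> nat \<Rightarrow> (nat \<times> nat) \<times> nat" where
  "domino_of_part a b (n, c) =
     (if c < b then ((n, 0), c)
      else ((n - (c - b) div a, Suc ((c - b) div a)), (c - b) mod a))"

lemma bij_betw_part_of_domino:
  "bij_betw (part_of_domino a b) (colored_dominos a b) (colored_parts a b)"
proof (rule bij_betw_byWitness[where f' = "domino_of_part a b"])
  show "\<forall>x\<in>colored_dominos a b. domino_of_part a b (part_of_domino a b x) = x"
    by (auto simp: colored_dominos_def split: if_splits)
  show "\<forall>y\<in>colored_parts a b. part_of_domino a b (domino_of_part a b y) = y"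
  proof
    fix y assume y: "y \<in> colored_parts a b"
    obtain n c where [simp]: "y = (n, c)" by fastforce
    show "part_of_domino a b (domino_of_part a b y) = y"
    proof (cases "c < b")
      case False
      then have "c - b < n * a"
        using y by (simp add: colored_parts_def algebra_simps less_diff_conv2)
      then have "(c - b) div a < n"
        by (rule less_mult_imp_div_less)
      then show ?thesis using False by simp
    qed simp
  qed
  show "part_of_domino a b ` colored_dominos a b \<subseteq> colored_parts a b"
  proof -
    have "a * (\<beta> - 1) + c < a * (\<alpha> + \<beta> - 1)" if "0 < \<alpha>" "0 < \<beta>" "c < a" for \<alpha> \<beta> c :: nat
    proof -
      have "a * (\<beta> - 1) + c < a * \<beta>"
        using that by (cases \<beta>) auto
      also have "\<dots> \<le> a * (\<alpha> + \<beta> - 1)"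
        using that by (intro mult_le_mono2) linarith
      finally show ?thesis .
    qed
    then show ?thesis
      by (auto simp: colored_dominos_def colored_parts_def split: if_splits)
  qed
  show "domino_of_part a b ` colored_parts a b \<subseteq> colored_dominos a b"
  proof (rule image_subsetI)
    fix y assume y: "y \<in> colored_parts a b"
    obtain n c where [simp]: "y = (n, c)" by fastforce
    show "domino_of_part a b y \<in> colored_dominos a b"
    proof (cases "c < b")
      case True
      then show ?thesis
        using y by (simp add: colored_dominos_def colored_parts_def)
    next
      case False
      then have less: "c - b < n * a"
        using y by (simp add: colored_parts_def algebra_simps less_diff_conv2)
      then have "0 < a" by (cases a) auto
      with less False show ?thesis
        by (simp add: colored_dominos_def less_mult_imp_div_less)
    qed
  qed
qed

lemma sum_domino_eq:
  assumes "ds \<in> lists (colored_dominos a b)"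
  shows "(\<Sum>(\<alpha>, \<beta>)\<leftarrow>map fst ds. \<alpha> + \<beta>) =
    (\<Sum>d\<leftarrow>ds. fst (part_of_domino a b d)) + length (filter nonzero_domino (map fst ds))"
  using assms
  by (induction ds) (auto simp: colored_dominos_def nonzero_domino_def)

lemma length_le_sum_list:
  fixes ns :: "nat list"
  assumes "\<forall>n\<in>set ns. 0 < n"
  shows "length ns \<le> sum_list ns"
  using assms by (induction ns) auto

text \<open>
  Once the parts add up to \<open>n\<close>, each of them is at most \<open>n\<close>, which bounds \<open>\<alpha>\<close> and \<open>\<beta>\<close>; and since the
  parts are positive, there are at most \<open>n\<close> dominos, which bounds the number of nonzero ones.
\<close>

lemma T_all_eq:
  "T_all a b n k =
    {ds \<in> lists (colored_dominos a b).
       length ds = k \<and> (\<Sum>d\<leftarrow>ds. fst (part_of_domino a b d)) = n}"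
  (is "_ = ?R")
proof (intro equalityI subsetI)
  fix ds assume "ds \<in> T_all a b n k"
  then obtain j where ds: "ds \<in> T_nonzero a b j n k"
    by (auto simp: T_all_def)
  have "((\<alpha>, \<beta>), c) \<in> colored_dominos a b" if "((\<alpha>, \<beta>), c) \<in> set ds" for \<alpha> \<beta> c
  proof -
    have "(\<alpha>, \<beta>) \<in> set (map fst ds)"
      using that by force
    then have "0 < \<alpha>"
      using ds by (auto simp: T_nonzero_def domino_compositions_def dominos_def)
    moreover have "c < (if \<beta> = 0 then b else a)"
    proof -
      have "\<forall>(d, c)\<in>set ds. (nonzero_domino d \<longrightarrow> c < a) \<and> (zero_domino d \<longrightarrow> c < b)"
        using ds by (simp add: T_nonzero_def)
      from bspec[OF this that] show ?thesis
        by (simp add: nonzero_domino_def zero_domino_def)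
    qed
    ultimately show ?thesis by (simp add: colored_dominos_def)
  qed
  then have "ds \<in> lists (colored_dominos a b)" by auto
  with ds sum_domino_eq[OF this] show "ds \<in> ?R"
    by (simp add: T_nonzero_def domino_compositions_def)
next
  fix ds assume "ds \<in> ?R"
  then have ds: "ds \<in> lists (colored_dominos a b)" and len: "length ds = k"
    and sum: "(\<Sum>d\<leftarrow>ds. fst (part_of_domino a b d)) = n" by auto
  define j where "j = length (filter nonzero_domino (map fst ds))"
  have pos: "\<forall>m\<in>set (map (\<lambda>d. fst (part_of_domino a b d)) ds). 0 < m"
    using ds by (auto simp: colored_dominos_def)
  have "j \<le> length ds"
    using length_filter_le[of nonzero_domino "map fst ds"] by (simp add: j_def)
  also have "length ds \<le> n"
    using length_le_sum_list[OF pos] sum by simp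
  finally have "j \<le> n" .
  have "set (map fst ds) \<subseteq> dominos n"
  proof -
    have "d \<in> dominos n" if "(d, c) \<in> set ds" for d c
    proof -
      have "fst (part_of_domino a b (d, c)) \<le> n"
        using that unfolding sum[symmetric] by (intro member_le_sum_list) force+
      moreover have "(d, c) \<in> colored_dominos a b"
        using that ds by auto
      ultimately show ?thesis
        by (auto simp: colored_dominos_def dominos_def split: if_splits)
    qed
    then show ?thesis by auto
  qed
  moreover have "length (filter zero_domino (map fst ds)) = k - j"
  proof -
    have "zero_domino = (\<lambda>d. \<not> nonzero_domino d)"
      by (auto simp: zero_domino_def nonzero_domino_def)
    then show ?thesis
      using sum_length_filter_compl[of nonzero_domino "map fst ds"] len by (simp add: j_def)
  qed
  moreover have "\<forall>(d, c)\<in>set ds. (nonzero_domino d \<longrightarrow> c < a) \<and> (zero_domino d \<longrightarrow> c < b)"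
  proof (safe)
    fix \<alpha> \<beta> c assume "((\<alpha>, \<beta>), c) \<in> set ds"
    then have "((\<alpha>, \<beta>), c) \<in> colored_dominos a b"
      using ds by auto
    then show "nonzero_domino (\<alpha>, \<beta>) \<Longrightarrow> c < a" "zero_domino (\<alpha>, \<beta>) \<Longrightarrow> c < b"
      by (auto simp: colored_dominos_def nonzero_domino_def zero_domino_def split: if_splits)
  qed
  moreover have "(\<Sum>(\<alpha>, \<beta>)\<leftarrow>map fst ds. \<alpha> + \<beta>) = n + j"
    using sum_domino_eq[OF ds] sum by (simp only: j_def)
  ultimately have "ds \<in> T_nonzero a b j n k"
    using len j_def[symmetric]
    unfolding T_nonzero_def domino_compositions_def by simp
  with \<open>j \<le> n\<close> show "ds \<in> T_all a b n k"
    by (auto simp: T_all_def)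
qed

lemma color_compositions_eq:
  "color_compositions a b n k =
    {ps \<in> lists (colored_parts a b). length ps = k \<and> (\<Sum>p\<leftarrow>ps. fst p) = n}"
proof -
  have "ps \<in> lists (colored_parts a b) \<longleftrightarrow>
      (\<forall>n\<in>set (map fst ps). 0 < n) \<and> (\<forall>(n, c)\<in>set ps. c < a * n + b)" for ps
    by (induction ps) (auto simp: colored_parts_def)
  then show ?thesis
    by (auto simp: color_compositions_def compositions_def)
qed

lemma bij_betw_restrict_pred:
  assumes "bij_betw f A B" and "\<And>x. x \<in> A \<Longrightarrow> P x \<longleftrightarrow> Q (f x)"
  shows "bij_betw f {x \<in> A. P x} {y \<in> B. Q y}"
proof (rule bij_betw_subset[OF assms(1)])
  show "f ` {x \<in> A. P x} = {y \<in> B. Q y}"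
    using assms(2) bij_betw_imp_surj_on[OF assms(1)] by blast
qed blast

theorem theorem6:
  fixes a b \<nu> k :: nat
  assumes "\<nu> \<ge> 1" and "k \<ge> 1"
  shows "\<exists>\<phi>. bij_betw \<phi> (T_all a b \<nu> k) (color_compositions a b \<nu> k)"
proof -
  have "bij_betw (map (part_of_domino a b)) (T_all a b \<nu> k) (color_compositions a b \<nu> k)"
    unfolding T_all_eq color_compositions_eq
    by (rule bij_betw_restrict_pred[OF bij_lists[OF bij_betw_part_of_domino]])
       (simp add: comp_def)
  then show ?thesis by blast
qed

end
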